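(* A Hom-Leibniz algebra $(\mathfrak g,\alpha_{\mathfrak g})$ over a field $\mathbb K$ is capable if and only if $Z^{\curlywedge}_{\alpha}(\mathfrak g)=0$.
   Context: All vector spaces and linear maps are over a fixed field $\mathbb K$. A (multiplicative) Hom-Leibniz algebra $(\mathfrak g,\alpha_{\mathfrak g})$ is a vector space $\mathfrak g$ with a bilinear product $[\,,]$ and a linear map $\alpha_{\mathfrak g}$ such that $[\alpha_{\mathfrak g}(x),[y,z]]=[[x,y],\alpha_{\mathfrak g}(z)]-[[x,z],\alpha_{\mathfrak g}(y)]$ and $\alpha_{\mathfrak g}([x,y])=[\alpha_{\mathfrak g}(x),\alpha_{\mathfrak g}(y)]$. Homomorphisms are linear maps preserving products and commuting with the self-maps. The $\alpha$-center is $Z_\alpha(\mathfrak g)=\{x\in\mathfrak g\mid[\alpha_{\mathfrak g}^n(x),y]=[y,\alpha_{\mathfrak g}^n(x)]=0\text{ for all }y\in\mathfrak g,\ n\ge0\}$ (an ideal). $(\mathfrak g,\alpha_{\mathfrak g})$ is capable if there is a Hom-Leibniz algebra $(\mathfrak k,\alpha_{\mathfrak k})$ with $(\mathfrak g,\alpha_{\mathfrak g})\cong(\mathfrak k/Z_\alpha(\mathfrak k),\bar\alpha_{\mathfrak k})$, $\bar\alpha_{\mathfrak k}$ being the induced map. Exterior product: $(\mathfrak g\curlywedge\mathfrak g,\alpha_{\mathfrak g\curlywedge\mathfrak g})$ is the Hom-Leibniz algebra generated by symbols $x\curlywedge y$ ($x,y\in\mathfrak g$), bilinear in $(x,y)$,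 subject to, for all $x,y,z,x',y'\in\mathfrak g$: $\alpha_{\mathfrak g}(x)\curlywedge[y,z]=-\alpha_{\mathfrak g}(x)\curlywedge[z,y]$; $\alpha_{\mathfrak g}(x)\curlywedge[y,z]=[x,y]\curlywedge\alpha_{\mathfrak g}(z)-[x,z]\curlywedge\alpha_{\mathfrak g}(y)$; $[x,y]\curlywedge\alpha_{\mathfrak g}(z)=[x,z]\curlywedge\alpha_{\mathfrak g}(y)-\alpha_{\mathfrak g}(x)\curlywedge[z,y]$; $[x\curlywedge y,x'\curlywedge y']=[x,y]\curlywedge[x',y']$; with $\alpha_{\mathfrak g\curlywedge\mathfrak g}(x\curlywedge y)=\alpha_{\mathfrak g}(x)\curlywedge\alpha_{\mathfrak g}(y)$. The exterior center is $Z^{\curlywedge}_\alpha(\mathfrak g)=\{x\in\mathfrak g\mid\alpha^k_{\mathfrak g}(x)\curlywedge y=y\curlywedge\alpha^k_{\mathfrak g}(x)=0\text{ in }\mathfrak g\curlywedge\mathfrak g\text{ for all }y\in\mathfrak g,\ k\ge0\}$. *)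

theory Defs
  imports "HOL-Algebra.Module" "HOL-Algebra.QuotRing"
begin

section \<open>Hom-Leibniz algebras\<close>

text \<open>
  The bracket is the \<^const>\<open>mult\<close> field, so that \<open>[x, y]\<close> is written \<open>x \<otimes> y\<close>; it is not
  associative in general.  The field \<^const>\<open>one\<close>, inherited from the ring records, carries no
  meaning and is never referred to.
\<close>

record ('k, 'a) hom_algebra = "('k, 'a) module" +
  twist :: "'a \<Rightarrow> 'a"

locale hom_leibniz_algebra = module K L
  for K :: "('k, 'r) ring_scheme" (structure) and L :: "('k, 'a) hom_algebra" (structure) +
  assumes field_K: "field K"
    and bracket_closed:
      "\<lbrakk>x \<in> carrier L; y \<in> carrier L\<rbrakk> \<Longrightarrow> x \<otimes>\<^bsub>L\<^esub> y \<in> carrier L"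
    and bracket_add_left:
      "\<lbrakk>x \<in> carrier L; y \<in> carrier L; z \<in> carrier L\<rbrakk> \<Longrightarrow>
        (x \<oplus>\<^bsub>L\<^esub> y) \<otimes>\<^bsub>L\<^esub> z = x \<otimes>\<^bsub>L\<^esub> z \<oplus>\<^bsub>L\<^esub> y \<otimes>\<^bsub>L\<^esub> z"
    and bracket_add_right:
      "\<lbrakk>x \<in> carrier L; y \<in> carrier L; z \<in> carrier L\<rbrakk> \<Longrightarrow>
        z \<otimes>\<^bsub>L\<^esub> (x \<oplus>\<^bsub>L\<^esub> y) = z \<otimes>\<^bsub>L\<^esub> x \<oplus>\<^bsub>L\<^esub> z \<otimes>\<^bsub>L\<^esub> y"
    and bracket_smult_left:
      "\<lbrakk>c \<in> carrier K; x \<in> carrier L; y \<in> carrier L\<rbrakk> \<Longrightarrow>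
        (c \<odot>\<^bsub>L\<^esub> x) \<otimes>\<^bsub>L\<^esub> y = c \<odot>\<^bsub>L\<^esub> (x \<otimes>\<^bsub>L\<^esub> y)"
    and bracket_smult_right:
      "\<lbrakk>c \<in> carrier K; x \<in> carrier L; y \<in> carrier L\<rbrakk> \<Longrightarrow>
        x \<otimes>\<^bsub>L\<^esub> (c \<odot>\<^bsub>L\<^esub> y) = c \<odot>\<^bsub>L\<^esub> (x \<otimes>\<^bsub>L\<^esub> y)"
    and twist_closed: "x \<in> carrier L \<Longrightarrow> twist L x \<in> carrier L"
    and twist_add:
      "\<lbrakk>x \<in> carrier L; y \<in> carrier L\<rbrakk> \<Longrightarrow> twist L (x \<oplus>\<^bsub>L\<^esub> y) = twist L x \<oplus>\<^bsub>L\<^esub> twist L y"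
    and twist_smult:
      "\<lbrakk>c \<in> carrier K; x \<in> carrier L\<rbrakk> \<Longrightarrow> twist L (c \<odot>\<^bsub>L\<^esub> x) = c \<odot>\<^bsub>L\<^esub> twist L x"
    and hom_leibniz:
      "\<lbrakk>x \<in> carrier L; y \<in> carrier L; z \<in> carrier L\<rbrakk> \<Longrightarrow>
        twist L x \<otimes>\<^bsub>L\<^esub> (y \<otimes>\<^bsub>L\<^esub> z) =
          (x \<otimes>\<^bsub>L\<^esub> y) \<otimes>\<^bsub>L\<^esub> twist L z \<ominus>\<^bsub>L\<^esub> (x \<otimes>\<^bsub>L\<^esub> z) \<otimes>\<^bsub>L\<^esub> twist L y"
    and multiplicative:
      "\<lbrakk>x \<in> carrier L; y \<in> carrier L\<rbrakk> \<Longrightarrow> twist L (x \<otimes>\<^bsub>L\<^esub> y) = twist L x \<otimes>\<^bsub>L\<^esub> twist L y"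

definition hom_leibniz_hom ::
    "('k, 'r) ring_scheme \<Rightarrow> ('k, 'a) hom_algebra \<Rightarrow> ('k, 'b) hom_algebra \<Rightarrow> ('a \<Rightarrow> 'b) set" where
  "hom_leibniz_hom K L M = {f \<in> carrier L \<rightarrow> carrier M.
     (\<forall>x\<in>carrier L. \<forall>y\<in>carrier L. f (x \<oplus>\<^bsub>L\<^esub> y) = f x \<oplus>\<^bsub>M\<^esub> f y) \<and>
     (\<forall>c\<in>carrier K. \<forall>x\<in>carrier L. f (c \<odot>\<^bsub>L\<^esub> x) = c \<odot>\<^bsub>M\<^esub> f x) \<and>
     (\<forall>x\<in>carrier L. \<forall>y\<in>carrier L. f (x \<otimes>\<^bsub>L\<^esub> y) = f x \<otimes>\<^bsub>M\<^esub> f y) \<and>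
     (\<forall>x\<in>carrier L. f (twist L x) = twist M (f x))}"

definition hom_leibniz_isomorphic ::
    "('k, 'r) ring_scheme \<Rightarrow> ('k, 'a) hom_algebra \<Rightarrow> ('k, 'b) hom_algebra \<Rightarrow> bool" where
  "hom_leibniz_isomorphic K L M \<longleftrightarrow>
     (\<exists>f \<in> hom_leibniz_hom K L M. bij_betw f (carrier L) (carrier M))"

section \<open>The \<open>\<alpha>\<close>-center and capability\<close>

definition alpha_center :: "('k, 'a) hom_algebra \<Rightarrow> 'a set" where
  "alpha_center L = {x \<in> carrier L. \<forall>y\<in>carrier L. \<forall>n.
     (twist L ^^ n) x \<otimes>\<^bsub>L\<^esub> y = \<zero>\<^bsub>L\<^esub> \<and> y \<otimes>\<^bsub>L\<^esub> (twist L ^^ n) x = \<zero>\<^bsub>L\<^esub>}"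

text \<open>
  The quotient by a two-sided ideal \<open>I\<close> stable under the twist.  As in \<^const>\<open>FactRing\<close>, the
  elements are the cosets of \<open>I\<close>, and the operations on cosets are unions over representatives.
\<close>

definition quot_hom_algebra :: "('k, 'a) hom_algebra \<Rightarrow> 'a set \<Rightarrow> ('k, 'a set) hom_algebra" where
  "quot_hom_algebra L I =
     \<lparr>carrier = a_rcosets\<^bsub>L\<^esub> I,
      mult = rcoset_mult L I,
      one = undefined,
      zero = I,
      add = set_add L,
      smult = (\<lambda>c A. \<Union>a\<in>A. I +>\<^bsub>L\<^esub> (c \<odot>\<^bsub>L\<^esub> a)),
      twist = (\<lambda>A. \<Union>a\<in>A. I +>\<^bsub>L\<^esub> twist L a)\<rparr>"

text \<open>
  A formula of HOL cannot quantify over types, so the type \<open>'b\<close> of the elements of the witness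
  is a parameter.  Capability in the usual sense is the existence of a witness in some type:
  results that start from it should allow every \<open>'b\<close>, results that conclude it should name one.
\<close>

definition capable ::
    "'b itself \<Rightarrow> ('k, 'r) ring_scheme \<Rightarrow> ('k, 'a) hom_algebra \<Rightarrow> bool" where
  "capable u K L \<longleftrightarrow> (\<exists>E :: ('k, 'b) hom_algebra.
     hom_leibniz_algebra K E \<and>
     hom_leibniz_isomorphic K L (quot_hom_algebra E (alpha_center E)))"

section \<open>The exterior product\<close>

text \<open>
  The presentation by generators and relations: formal expressions in the symbols
  \<open>Wedge x y\<close> and the operations of a Hom-Leibniz algebra, modulo the least congruence that
  forces the Hom-Leibniz axioms and the defining relations.
\<close>

datatype ('k, 'a) ext_term =
    Wedge 'a 'a
  | Zero
  | Plus "('k, 'a) ext_term" "('k, 'a) ext_term"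
  | Neg "('k, 'a) ext_term"
  | Scale 'k "('k, 'a) ext_term"
  | Bracket "('k, 'a) ext_term" "('k, 'a) ext_term"
  | Twist "('k, 'a) ext_term"

inductive_set ext_terms ::
    "('k, 'r) ring_scheme \<Rightarrow> ('k, 'a) hom_algebra \<Rightarrow> ('k, 'a) ext_term set"
  for K :: "('k, 'r) ring_scheme" and L :: "('k, 'a) hom_algebra" where
  "\<lbrakk>x \<in> carrier L; y \<in> carrier L\<rbrakk> \<Longrightarrow> Wedge x y \<in> ext_terms K L"
| "Zero \<in> ext_terms K L"
| "\<lbrakk>s \<in> ext_terms K L; t \<in> ext_terms K L\<rbrakk> \<Longrightarrow> Plus s t \<in> ext_terms K L"
| "s \<in> ext_terms K L \<Longrightarrow> Neg s \<in> ext_terms K L"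
| "\<lbrakk>c \<in> carrier K; s \<in> ext_terms K L\<rbrakk> \<Longrightarrow> Scale c s \<in> ext_terms K L"
| "\<lbrakk>s \<in> ext_terms K L; t \<in> ext_terms K L\<rbrakk> \<Longrightarrow> Bracket s t \<in> ext_terms K L"
| "s \<in> ext_terms K L \<Longrightarrow> Twist s \<in> ext_terms K L"

inductive_set ext_cong ::
    "('k, 'r) ring_scheme \<Rightarrow> ('k, 'a) hom_algebra \<Rightarrow> (('k, 'a) ext_term \<times> ('k, 'a) ext_term) set"
  for K :: "('k, 'r) ring_scheme" and L :: "('k, 'a) hom_algebra" where
  \<comment> \<open>congruence\<close>
  refl: "s \<in> ext_terms K L \<Longrightarrow> (s, s) \<in> ext_cong K L"
| sym: "(s, t) \<in> ext_cong K L \<Longrightarrow> (t, s) \<in> ext_cong K L"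
| trans: "\<lbrakk>(s, t) \<in> ext_cong K L; (t, u) \<in> ext_cong K L\<rbrakk> \<Longrightarrow> (s, u) \<in> ext_cong K L"
| Plus_cong: "\<lbrakk>(s, s') \<in> ext_cong K L; (t, t') \<in> ext_cong K L\<rbrakk> \<Longrightarrow>
    (Plus s t, Plus s' t') \<in> ext_cong K L"
| Neg_cong: "(s, s') \<in> ext_cong K L \<Longrightarrow> (Neg s, Neg s') \<in> ext_cong K L"
| Scale_cong: "\<lbrakk>c \<in> carrier K; (s, s') \<in> ext_cong K L\<rbrakk> \<Longrightarrow>
    (Scale c s, Scale c s') \<in> ext_cong K L"
| Bracket_cong: "\<lbrakk>(s, s') \<in> ext_cong K L; (t, t') \<in> ext_cong K L\<rbrakk> \<Longrightarrow>
    (Bracket s t, Bracket s' t') \<in> ext_cong K L"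
| Twist_cong: "(s, s') \<in> ext_cong K L \<Longrightarrow> (Twist s, Twist s') \<in> ext_cong K L"
  \<comment> \<open>vector space axioms\<close>
| Plus_assoc: "\<lbrakk>s \<in> ext_terms K L; t \<in> ext_terms K L; u \<in> ext_terms K L\<rbrakk> \<Longrightarrow>
    (Plus (Plus s t) u, Plus s (Plus t u)) \<in> ext_cong K L"
| Plus_comm: "\<lbrakk>s \<in> ext_terms K L; t \<in> ext_terms K L\<rbrakk> \<Longrightarrow>
    (Plus s t, Plus t s) \<in> ext_cong K L"
| Plus_Zero: "s \<in> ext_terms K L \<Longrightarrow> (Plus Zero s, s) \<in> ext_cong K L"
| Plus_Neg: "s \<in> ext_terms K L \<Longrightarrow> (Plus (Neg s) s, Zero) \<in> ext_cong K L"
| Scale_add: "\<lbrakk>c \<in> carrier K; d \<in> carrier K; s \<in> ext_terms K L\<rbrakk> \<Longrightarrow>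
    (Scale (c \<oplus>\<^bsub>K\<^esub> d) s, Plus (Scale c s) (Scale d s)) \<in> ext_cong K L"
| Scale_Plus: "\<lbrakk>c \<in> carrier K; s \<in> ext_terms K L; t \<in> ext_terms K L\<rbrakk> \<Longrightarrow>
    (Scale c (Plus s t), Plus (Scale c s) (Scale c t)) \<in> ext_cong K L"
| Scale_mult: "\<lbrakk>c \<in> carrier K; d \<in> carrier K; s \<in> ext_terms K L\<rbrakk> \<Longrightarrow>
    (Scale (c \<otimes>\<^bsub>K\<^esub> d) s, Scale c (Scale d s)) \<in> ext_cong K L"
| Scale_one: "s \<in> ext_terms K L \<Longrightarrow> (Scale \<one>\<^bsub>K\<^esub> s, s) \<in> ext_cong K L"
  \<comment> \<open>Hom-Leibniz axioms\<close>
| Bracket_Plus_left: "\<lbrakk>s \<in> ext_terms K L; t \<in> ext_terms K L; u \<in> ext_terms K L\<rbrakk> \<Longrightarrow>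
    (Bracket (Plus s t) u, Plus (Bracket s u) (Bracket t u)) \<in> ext_cong K L"
| Bracket_Plus_right: "\<lbrakk>s \<in> ext_terms K L; t \<in> ext_terms K L; u \<in> ext_terms K L\<rbrakk> \<Longrightarrow>
    (Bracket u (Plus s t), Plus (Bracket u s) (Bracket u t)) \<in> ext_cong K L"
| Bracket_Scale_left: "\<lbrakk>c \<in> carrier K; s \<in> ext_terms K L; t \<in> ext_terms K L\<rbrakk> \<Longrightarrow>
    (Bracket (Scale c s) t, Scale c (Bracket s t)) \<in> ext_cong K L"
| Bracket_Scale_right: "\<lbrakk>c \<in> carrier K; s \<in> ext_terms K L; t \<in> ext_terms K L\<rbrakk> \<Longrightarrow>
    (Bracket s (Scale c t), Scale c (Bracket s t)) \<in> ext_cong K L"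
| Twist_Plus: "\<lbrakk>s \<in> ext_terms K L; t \<in> ext_terms K L\<rbrakk> \<Longrightarrow>
    (Twist (Plus s t), Plus (Twist s) (Twist t)) \<in> ext_cong K L"
| Twist_Scale: "\<lbrakk>c \<in> carrier K; s \<in> ext_terms K L\<rbrakk> \<Longrightarrow>
    (Twist (Scale c s), Scale c (Twist s)) \<in> ext_cong K L"
| Bracket_leibniz: "\<lbrakk>s \<in> ext_terms K L; t \<in> ext_terms K L; u \<in> ext_terms K L\<rbrakk> \<Longrightarrow>
    (Bracket (Twist s) (Bracket t u),
     Plus (Bracket (Bracket s t) (Twist u)) (Neg (Bracket (Bracket s u) (Twist t)))) \<in> ext_cong K L"
| Twist_Bracket: "\<lbrakk>s \<in> ext_terms K L; t \<in> ext_terms K L\<rbrakk> \<Longrightarrow>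
    (Twist (Bracket s t), Bracket (Twist s) (Twist t)) \<in> ext_cong K L"
  \<comment> \<open>bilinearity of the symbols\<close>
| Wedge_add_left: "\<lbrakk>x \<in> carrier L; y \<in> carrier L; z \<in> carrier L\<rbrakk> \<Longrightarrow>
    (Wedge (x \<oplus>\<^bsub>L\<^esub> y) z, Plus (Wedge x z) (Wedge y z)) \<in> ext_cong K L"
| Wedge_add_right: "\<lbrakk>x \<in> carrier L; y \<in> carrier L; z \<in> carrier L\<rbrakk> \<Longrightarrow>
    (Wedge z (x \<oplus>\<^bsub>L\<^esub> y), Plus (Wedge z x) (Wedge z y)) \<in> ext_cong K L"
| Wedge_smult_left: "\<lbrakk>c \<in> carrier K; x \<in> carrier L; y \<in> carrier L\<rbrakk> \<Longrightarrow>
    (Wedge (c \<odot>\<^bsub>L\<^esub> x) y, Scale c (Wedge x y)) \<in> ext_cong K L"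
| Wedge_smult_right: "\<lbrakk>c \<in> carrier K; x \<in> carrier L; y \<in> carrier L\<rbrakk> \<Longrightarrow>
    (Wedge x (c \<odot>\<^bsub>L\<^esub> y), Scale c (Wedge x y)) \<in> ext_cong K L"
  \<comment> \<open>defining relations of the exterior product\<close>
| Wedge_alternating: "\<lbrakk>x \<in> carrier L; y \<in> carrier L; z \<in> carrier L\<rbrakk> \<Longrightarrow>
    (Wedge (twist L x) (y \<otimes>\<^bsub>L\<^esub> z), Neg (Wedge (twist L x) (z \<otimes>\<^bsub>L\<^esub> y))) \<in> ext_cong K L"
| Wedge_leibniz: "\<lbrakk>x \<in> carrier L; y \<in> carrier L; z \<in> carrier L\<rbrakk> \<Longrightarrow>
    (Wedge (twist L x) (y \<otimes>\<^bsub>L\<^esub> z),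
     Plus (Wedge (x \<otimes>\<^bsub>L\<^esub> y) (twist L z)) (Neg (Wedge (x \<otimes>\<^bsub>L\<^esub> z) (twist L y)))) \<in> ext_cong K L"
| Wedge_leibniz': "\<lbrakk>x \<in> carrier L; y \<in> carrier L; z \<in> carrier L\<rbrakk> \<Longrightarrow>
    (Wedge (x \<otimes>\<^bsub>L\<^esub> y) (twist L z),
     Plus (Wedge (x \<otimes>\<^bsub>L\<^esub> z) (twist L y)) (Neg (Wedge (twist L x) (z \<otimes>\<^bsub>L\<^esub> y)))) \<in> ext_cong K L"
| Bracket_Wedge:
    "\<lbrakk>x \<in> carrier L; y \<in> carrier L; x' \<in> carrier L; y' \<in> carrier L\<rbrakk> \<Longrightarrow>
    (Bracket (Wedge x y) (Wedge x' y'), Wedge (x \<otimes>\<^bsub>L\<^esub> y) (x' \<otimes>\<^bsub>L\<^esub> y')) \<in> ext_cong K L"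
| Twist_Wedge: "\<lbrakk>x \<in> carrier L; y \<in> carrier L\<rbrakk> \<Longrightarrow>
    (Twist (Wedge x y), Wedge (twist L x) (twist L y)) \<in> ext_cong K L"

definition ext_class ::
    "('k, 'r) ring_scheme \<Rightarrow> ('k, 'a) hom_algebra \<Rightarrow> ('k, 'a) ext_term \<Rightarrow> ('k, 'a) ext_term set" where
  "ext_class K L t = ext_cong K L `` {t}"

definition exterior_product ::
    "('k, 'r) ring_scheme \<Rightarrow> ('k, 'a) hom_algebra \<Rightarrow> ('k, ('k, 'a) ext_term set) hom_algebra" where
  "exterior_product K L =
     \<lparr>carrier = ext_terms K L // ext_cong K L,
      mult = (\<lambda>A B. \<Union>s\<in>A. \<Union>t\<in>B. ext_class K L (Bracket s t)),
      one = undefined,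
      zero = ext_class K L Zero,
      add = (\<lambda>A B. \<Union>s\<in>A. \<Union>t\<in>B. ext_class K L (Plus s t)),
      smult = (\<lambda>c A. \<Union>s\<in>A. ext_class K L (Scale c s)),
      twist = (\<lambda>A. \<Union>s\<in>A. ext_class K L (Twist s))\<rparr>"

definition wedge ::
    "('k, 'r) ring_scheme \<Rightarrow> ('k, 'a) hom_algebra \<Rightarrow> 'a \<Rightarrow> 'a \<Rightarrow> ('k, 'a) ext_term set" where
  "wedge K L x y = ext_class K L (Wedge x y)"

definition exterior_center :: "('k, 'r) ring_scheme \<Rightarrow> ('k, 'a) hom_algebra \<Rightarrow> 'a set" where
  "exterior_center K L = {x \<in> carrier L. \<forall>y\<in>carrier L. \<forall>n.
     wedge K L ((twist L ^^ n) x) y = \<zero>\<^bsub>exterior_product K L\<^esub> \<and>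
     wedge K L y ((twist L ^^ n) x) = \<zero>\<^bsub>exterior_product K L\<^esub>}"

end

theory Submission
  imports Defs
begin

text \<open>
  Capability asks for a surjective homomorphism \<open>p : E \<rightarrow> L\<close> whose kernel is exactly the
  \<open>\<alpha>\<close>-center of \<open>E\<close>.  The exterior center is the obstruction to its existence, because \<open>(x, y) \<mapsto> x \<curlywedge> y\<close>
  is both a pairing through which every such \<open>E\<close> can be tested and a cocycle from which one can be built.

  Suppose that \<open>p : E \<rightarrow> L\<close> is given.  Elements of the \<open>\<alpha>\<close>-center annihilate \<open>E\<close>, so the bracket of \<open>E\<close>
  depends only on the images under \<open>p\<close> and defines a pairing \<open>\<omega> (p a) (p b) = [a, b]\<close> on \<open>L\<close>.  The
  Hom-Leibniz identity in \<open>E\<close> gives \<open>\<omega>\<close> all the defining relations of the exterior product, hence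
  \<open>\<omega> x y = 0\<close> whenever \<open>x \<curlywedge> y = 0\<close> (\<open>vanishes_if_wedge_zero\<close>).  If \<open>p a\<close> lies in the exterior center, then
  every \<open>\<alpha>\<^sup>n(a)\<close> annihilates \<open>E\<close>, so \<open>a\<close> is in the \<open>\<alpha>\<close>-center and \<open>p a = 0\<close>
  (\<open>exterior_center_trivial_if_cover\<close>).

  Conversely, one of the relations of the exterior product says that \<open>\<curlywedge>\<close> is a 2-cocycle with values in
  \<open>L \<curlywedge> L\<close>.  It defines a Hom-Leibniz algebra \<open>E = L \<times> (L \<curlywedge> L)\<close> with
  \<open>[(x, u), (y, v)] = ([x, y], x \<curlywedge> y)\<close>.  There \<open>(x, u)\<close> is in the \<open>\<alpha>\<close>-center if and only if \<open>x\<close> is in the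
  \<open>\<alpha>\<close>-center and in the exterior center of \<open>L\<close>.  If the latter is zero, the first projection has
  the \<open>\<alpha>\<close>-center as its kernel (\<open>wedge_extension_cover\<close>).
\<close>

section \<open>The \<open>\<alpha>\<close>-center and its quotient\<close>

context hom_leibniz_algebra
begin

lemma minus_eq_zero_iff:
  assumes "x \<in> carrier L" "y \<in> carrier L"
  shows "x \<ominus>\<^bsub>L\<^esub> y = \<zero>\<^bsub>L\<^esub> \<longleftrightarrow> x = y"
proof
  assume "x \<ominus>\<^bsub>L\<^esub> y = \<zero>\<^bsub>L\<^esub>"
  then have "\<ominus>\<^bsub>L\<^esub> (\<ominus>\<^bsub>L\<^esub> y) = x"
    using assms by (intro M.minus_equality) (simp_all add: M.minus_eq)
  then show "x = y"
    using assms by simp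
qed (use assms in \<open>simp add: M.minus_eq M.r_neg\<close>)

lemma bracket_zero_left: "y \<in> carrier L \<Longrightarrow> \<zero>\<^bsub>L\<^esub> \<otimes>\<^bsub>L\<^esub> y = \<zero>\<^bsub>L\<^esub>"
  using bracket_smult_left[of "\<zero>\<^bsub>K\<^esub>" "\<zero>\<^bsub>L\<^esub>" y] by (simp add: bracket_closed)

lemma bracket_zero_right: "y \<in> carrier L \<Longrightarrow> y \<otimes>\<^bsub>L\<^esub> \<zero>\<^bsub>L\<^esub> = \<zero>\<^bsub>L\<^esub>"
  using bracket_smult_right[of "\<zero>\<^bsub>K\<^esub>" y "\<zero>\<^bsub>L\<^esub>"] by (simp add: bracket_closed)

lemma twist_zero: "twist L \<zero>\<^bsub>L\<^esub> = \<zero>\<^bsub>L\<^esub>"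
  using twist_smult[of "\<zero>\<^bsub>K\<^esub>" "\<zero>\<^bsub>L\<^esub>"] by (simp add: twist_closed)

lemma twist_funpow_closed: "x \<in> carrier L \<Longrightarrow> (twist L ^^ n) x \<in> carrier L"
  by (induction n) (simp_all add: twist_closed)

lemma twist_funpow_zero: "(twist L ^^ n) \<zero>\<^bsub>L\<^esub> = \<zero>\<^bsub>L\<^esub>"
  by (induction n) (simp_all add: twist_zero)

lemma twist_funpow_add:
  "\<lbrakk>x \<in> carrier L; y \<in> carrier L\<rbrakk> \<Longrightarrow>
    (twist L ^^ n) (x \<oplus>\<^bsub>L\<^esub> y) = (twist L ^^ n) x \<oplus>\<^bsub>L\<^esub> (twist L ^^ n) y"
  by (induction n) (simp_all add: twist_add twist_funpow_closed)

lemma twist_funpow_smult: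
  "\<lbrakk>c \<in> carrier K; x \<in> carrier L\<rbrakk> \<Longrightarrow> (twist L ^^ n) (c \<odot>\<^bsub>L\<^esub> x) = c \<odot>\<^bsub>L\<^esub> (twist L ^^ n) x"
  by (induction n) (simp_all add: twist_smult twist_funpow_closed)

lemma alpha_center_closed: "z \<in> alpha_center L \<Longrightarrow> z \<in> carrier L"
  by (simp add: alpha_center_def)

lemma alpha_center_bracket:
  assumes "z \<in> alpha_center L" "y \<in> carrier L"
  shows "z \<otimes>\<^bsub>L\<^esub> y = \<zero>\<^bsub>L\<^esub>" "y \<otimes>\<^bsub>L\<^esub> z = \<zero>\<^bsub>L\<^esub>"
proof -
  have "(twist L ^^ 0) z \<otimes>\<^bsub>L\<^esub> y = \<zero>\<^bsub>L\<^esub> \<and> y \<otimes>\<^bsub>L\<^esub> (twist L ^^ 0) z = \<zero>\<^bsub>L\<^esub>"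
    using assms unfolding alpha_center_def by blast
  then show "z \<otimes>\<^bsub>L\<^esub> y = \<zero>\<^bsub>L\<^esub>" "y \<otimes>\<^bsub>L\<^esub> z = \<zero>\<^bsub>L\<^esub>"
    by simp_all
qed

lemma alpha_center_zero: "\<zero>\<^bsub>L\<^esub> \<in> alpha_center L"
  by (simp add: alpha_center_def twist_funpow_zero bracket_zero_left bracket_zero_right)

lemma alpha_center_add:
  "\<lbrakk>y \<in> alpha_center L; z \<in> alpha_center L\<rbrakk> \<Longrightarrow> y \<oplus>\<^bsub>L\<^esub> z \<in> alpha_center L"
  by (simp add: alpha_center_def twist_funpow_add twist_funpow_closed
      bracket_add_left bracket_add_right)

lemma alpha_center_smult:
  "\<lbrakk>c \<in> carrier K; z \<in> alpha_center L\<rbrakk> \<Longrightarrow> c \<odot>\<^bsub>L\<^esub> z \<in> alpha_center L"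
  by (simp add: alpha_center_def twist_funpow_smult twist_funpow_closed
      bracket_smult_left bracket_smult_right)

lemma alpha_center_twist: "z \<in> alpha_center L \<Longrightarrow> twist L z \<in> alpha_center L"
  unfolding alpha_center_def mem_Collect_eq
  by (metis twist_closed funpow_swap1 funpow_simps_right(2) comp_apply)

lemma alpha_center_minus:
  assumes "z \<in> alpha_center L"
  shows "\<ominus>\<^bsub>L\<^esub> z \<in> alpha_center L"
proof -
  have "\<ominus>\<^bsub>L\<^esub> z = (\<ominus>\<^bsub>K\<^esub> \<one>\<^bsub>K\<^esub>) \<odot>\<^bsub>L\<^esub> z"
    using assms by (simp add: smult_l_minus alpha_center_closed)
  then show ?thesis
    using assms by (simp add: alpha_center_smult)
qed

lemma alpha_center_abelian_subgroup: "abelian_subgroup (alpha_center L) L"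
proof (rule abelian_subgroupI3)
  show "additive_subgroup (alpha_center L) L"
    by (intro additive_subgroup.intro M.add.subgroupI)
      (use alpha_center_zero alpha_center_closed alpha_center_add alpha_center_minus in
        \<open>auto simp: a_inv_def[symmetric]\<close>)
  show "abelian_group L" ..
qed

lemma alpha_center_coset_iff:
  assumes "a \<in> carrier L" "b \<in> carrier L"
  shows "alpha_center L +>\<^bsub>L\<^esub> a = alpha_center L +>\<^bsub>L\<^esub> b \<longleftrightarrow> b \<ominus>\<^bsub>L\<^esub> a \<in> alpha_center L"
proof -
  interpret Z: abelian_subgroup "alpha_center L" L
    by (rule alpha_center_abelian_subgroup)
  show ?thesis
    using Z.a_rcos_module[OF assms] Z.a_repr_independence'[of b a] Z.a_rcos_self[OF assms(2)]
      assms by (metis minus_eq)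
qed

text \<open>
  The bracket factors through the quotient by the center in each argument: this is what makes
  brackets of lifts independent of the lifts.
\<close>

lemma bracket_cong_alpha_center:
  assumes "a \<in> carrier L" "a' \<in> carrier L" "b \<in> carrier L" "b' \<in> carrier L"
    and "a' \<ominus>\<^bsub>L\<^esub> a \<in> alpha_center L" "b' \<ominus>\<^bsub>L\<^esub> b \<in> alpha_center L"
  shows "a' \<otimes>\<^bsub>L\<^esub> b' = a \<otimes>\<^bsub>L\<^esub> b"
proof -
  have a': "a' = (a' \<ominus>\<^bsub>L\<^esub> a) \<oplus>\<^bsub>L\<^esub> a" and b': "b' = (b' \<ominus>\<^bsub>L\<^esub> b) \<oplus>\<^bsub>L\<^esub> b"
    using assms by (simp_all add: M.minus_eq M.a_assoc M.l_neg)
  have "a' \<otimes>\<^bsub>L\<^esub> b' = a \<otimes>\<^bsub>L\<^esub> b'"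
    using assms by (subst a') (simp add: bracket_add_left alpha_center_bracket bracket_closed)
  also have "\<dots> = a \<otimes>\<^bsub>L\<^esub> b"
    using assms by (subst b') (simp add: bracket_add_right alpha_center_bracket bracket_closed)
  finally show ?thesis .
qed

text \<open>
  The operations on cosets are unions over all representatives.  They collapse to a single coset
  because the center is a submodule stable under the twist and the bracket does not depend on the
  representatives.
\<close>

lemma quot_alpha_center_simps:
  fixes q defines "q \<equiv> (\<lambda>a. alpha_center L +>\<^bsub>L\<^esub> a)"
  shows "carrier (quot_hom_algebra L (alpha_center L)) = q ` carrier L"
    and "\<lbrakk>a \<in> carrier L; b \<in> carrier L\<rbrakk> \<Longrightarrow>
      q a \<oplus>\<^bsub>quot_hom_algebra L (alpha_center L)\<^esub> q b = q (a \<oplus>\<^bsub>L\<^esub> b)"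
    and "\<lbrakk>c \<in> carrier K; a \<in> carrier L\<rbrakk> \<Longrightarrow>
      c \<odot>\<^bsub>quot_hom_algebra L (alpha_center L)\<^esub> q a = q (c \<odot>\<^bsub>L\<^esub> a)"
    and "\<lbrakk>a \<in> carrier L; b \<in> carrier L\<rbrakk> \<Longrightarrow>
      q a \<otimes>\<^bsub>quot_hom_algebra L (alpha_center L)\<^esub> q b = q (a \<otimes>\<^bsub>L\<^esub> b)"
    and "a \<in> carrier L \<Longrightarrow>
      twist (quot_hom_algebra L (alpha_center L)) (q a) = q (twist L a)"
proof -
  interpret Z: abelian_subgroup "alpha_center L" L
    by (rule alpha_center_abelian_subgroup)
  have q_mem: "a' \<in> carrier L \<and> a' \<ominus>\<^bsub>L\<^esub> a \<in> alpha_center L" if "a \<in> carrier L" "a' \<in> q a" for a a'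
    using that Z.a_rcos_module[of a a'] Z.a_elemrcos_carrier[of a a'] by (simp add: q_def M.minus_eq)
  have q_nonempty: "q a \<noteq> {}" if "a \<in> carrier L" for a
    using Z.a_rcos_self[OF that] by (auto simp: q_def)
  show "carrier (quot_hom_algebra L (alpha_center L)) = q ` carrier L"
    by (auto simp: quot_hom_algebra_def A_RCOSETS_def' q_def)
  show "q a \<oplus>\<^bsub>quot_hom_algebra L (alpha_center L)\<^esub> q b = q (a \<oplus>\<^bsub>L\<^esub> b)"
    if "a \<in> carrier L" "b \<in> carrier L"
    using that by (simp add: quot_hom_algebra_def q_def Z.a_rcos_sum)
  show "c \<odot>\<^bsub>quot_hom_algebra L (alpha_center L)\<^esub> q a = q (c \<odot>\<^bsub>L\<^esub> a)"
    if c: "c \<in> carrier K" and a: "a \<in> carrier L"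
  proof -
    have "q (c \<odot>\<^bsub>L\<^esub> a') = q (c \<odot>\<^bsub>L\<^esub> a)" if "a' \<in> q a" for a'
    proof -
      have "c \<odot>\<^bsub>L\<^esub> a' \<ominus>\<^bsub>L\<^esub> c \<odot>\<^bsub>L\<^esub> a = c \<odot>\<^bsub>L\<^esub> (a' \<ominus>\<^bsub>L\<^esub> a)"
        using c a q_mem[OF a that] by (simp add: M.minus_eq smult_r_distr smult_r_minus)
      then show ?thesis
        using c a q_mem[OF a that] alpha_center_coset_iff[of "c \<odot>\<^bsub>L\<^esub> a" "c \<odot>\<^bsub>L\<^esub> a'"]
        by (simp add: q_def alpha_center_smult)
    qed
    then have "(\<Union>a'\<in>q a. q (c \<odot>\<^bsub>L\<^esub> a')) = q (c \<odot>\<^bsub>L\<^esub> a)"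
      by (intro SUP_eq_const q_nonempty a)
    then show ?thesis
      by (simp add: quot_hom_algebra_def q_def)
  qed
  show "q a \<otimes>\<^bsub>quot_hom_algebra L (alpha_center L)\<^esub> q b = q (a \<otimes>\<^bsub>L\<^esub> b)"
    if a: "a \<in> carrier L" and b: "b \<in> carrier L"
  proof -
    have "a' \<otimes>\<^bsub>L\<^esub> b' = a \<otimes>\<^bsub>L\<^esub> b" if "a' \<in> q a" "b' \<in> q b" for a' b'
      using q_mem[OF a that(1)] q_mem[OF b that(2)] a b by (blast intro: bracket_cong_alpha_center)
    then have "(\<Union>a'\<in>q a. \<Union>b'\<in>q b. q (a' \<otimes>\<^bsub>L\<^esub> b')) = q (a \<otimes>\<^bsub>L\<^esub> b)"
      by (intro SUP_eq_const q_nonempty a b) simp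
    then show ?thesis
      by (simp add: quot_hom_algebra_def rcoset_mult_def q_def)
  qed
  show "twist (quot_hom_algebra L (alpha_center L)) (q a) = q (twist L a)" if a: "a \<in> carrier L"
  proof -
    have "q (twist L a') = q (twist L a)" if "a' \<in> q a" for a'
    proof -
      have "a' = (a' \<ominus>\<^bsub>L\<^esub> a) \<oplus>\<^bsub>L\<^esub> a"
        using a q_mem[OF a that] by (simp add: M.minus_eq M.a_assoc M.l_neg)
      then have "twist L a' = twist L (a' \<ominus>\<^bsub>L\<^esub> a) \<oplus>\<^bsub>L\<^esub> twist L a"
        using a q_mem[OF a that] by (metis twist_add M.minus_closed)
      then have "twist L a' \<ominus>\<^bsub>L\<^esub> twist L a = twist L (a' \<ominus>\<^bsub>L\<^esub> a)"
        using a q_mem[OF a that] by (simp add: M.minus_eq M.a_assoc M.r_neg twist_closed)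
      then show ?thesis
        using a q_mem[OF a that] alpha_center_coset_iff[of "twist L a" "twist L a'"]
        by (simp add: q_def alpha_center_twist twist_closed)
    qed
    then have "(\<Union>a'\<in>q a. q (twist L a')) = q (twist L a)"
      by (intro SUP_eq_const q_nonempty a)
    then show ?thesis
      by (simp add: quot_hom_algebra_def q_def)
  qed
qed

end

section \<open>Capability in terms of surjections\<close>

lemma hom_leibniz_homD:
  assumes "p \<in> hom_leibniz_hom K E L"
  shows "a \<in> carrier E \<Longrightarrow> p a \<in> carrier L"
    and "\<lbrakk>a \<in> carrier E; b \<in> carrier E\<rbrakk> \<Longrightarrow> p (a \<oplus>\<^bsub>E\<^esub> b) = p a \<oplus>\<^bsub>L\<^esub> p b"
    and "\<lbrakk>c \<in> carrier K; a \<in> carrier E\<rbrakk> \<Longrightarrow> p (c \<odot>\<^bsub>E\<^esub> a) = c \<odot>\<^bsub>L\<^esub> p a"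
    and "\<lbrakk>a \<in> carrier E; b \<in> carrier E\<rbrakk> \<Longrightarrow> p (a \<otimes>\<^bsub>E\<^esub> b) = p a \<otimes>\<^bsub>L\<^esub> p b"
    and "a \<in> carrier E \<Longrightarrow> p (twist E a) = twist L (p a)"
  using assms by (auto simp: hom_leibniz_hom_def)

lemma hom_leibniz_hom_minus:
  assumes "hom_leibniz_algebra K E" "hom_leibniz_algebra K L" "p \<in> hom_leibniz_hom K E L"
    and "a \<in> carrier E" "b \<in> carrier E"
  shows "p (a \<ominus>\<^bsub>E\<^esub> b) = p a \<ominus>\<^bsub>L\<^esub> p b"
proof -
  interpret E: hom_leibniz_algebra K E by fact
  interpret L: hom_leibniz_algebra K L by fact
  note p = hom_leibniz_homD[OF assms(3)]
  have E: "a \<ominus>\<^bsub>E\<^esub> b = a \<oplus>\<^bsub>E\<^esub> (\<ominus>\<^bsub>K\<^esub> \<one>\<^bsub>K\<^esub>) \<odot>\<^bsub>E\<^esub> b"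
    using assms(4,5) by (simp add: E.smult_l_minus E.M.minus_eq)
  have L: "p a \<ominus>\<^bsub>L\<^esub> p b = p a \<oplus>\<^bsub>L\<^esub> (\<ominus>\<^bsub>K\<^esub> \<one>\<^bsub>K\<^esub>) \<odot>\<^bsub>L\<^esub> p b"
    using assms(4,5) by (simp add: L.smult_l_minus L.M.minus_eq p)
  show ?thesis
    unfolding E L using assms(4,5) by (simp add: p)
qed

definition alpha_central_cover ::
    "('k, 'r) ring_scheme \<Rightarrow> ('k, 'b) hom_algebra \<Rightarrow> ('k, 'a) hom_algebra \<Rightarrow> ('b \<Rightarrow> 'a) \<Rightarrow> bool" where
  "alpha_central_cover K E L p \<longleftrightarrow>
     hom_leibniz_algebra K E \<and> p \<in> hom_leibniz_hom K E L \<and> p ` carrier E = carrier L \<and>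
     (\<forall>a\<in>carrier E. p a = \<zero>\<^bsub>L\<^esub> \<longleftrightarrow> a \<in> alpha_center E)"

text \<open>
  The first isomorphism theorem, for the ideal \<open>Z\<^sub>\<alpha>(E)\<close>: it trades the algebra of cosets in the
  definition of capability for a surjection.
\<close>

lemma capable_iff_alpha_central_cover:
  fixes K :: "('k, 'r) ring_scheme" and L :: "('k, 'a) hom_algebra"
  assumes L: "hom_leibniz_algebra K L"
  shows "capable TYPE('b) K L \<longleftrightarrow>
    (\<exists>(E :: ('k, 'b) hom_algebra) p. alpha_central_cover K E L p)"
proof
  interpret L: hom_leibniz_algebra K L by (rule L)
  assume "capable TYPE('b) K L"
  then obtain E :: "('k, 'b) hom_algebra" and f
    where E: "hom_leibniz_algebra K E"
      and f: "f \<in> hom_leibniz_hom K L (quot_hom_algebra E (alpha_center E))"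
      and bij: "bij_betw f (carrier L) (carrier (quot_hom_algebra E (alpha_center E)))"
    unfolding capable_def hom_leibniz_isomorphic_def by blast
  interpret E: hom_leibniz_algebra K E by (rule E)
  define q where "q = (\<lambda>a. alpha_center E +>\<^bsub>E\<^esub> a)"
  note Q = E.quot_alpha_center_simps[folded q_def]
  note f_hom = hom_leibniz_homD[OF f]
  define p where "p = (\<lambda>a. inv_into (carrier L) f (q a))"
  have p_closed: "p a \<in> carrier L" and f_p: "f (p a) = q a" if "a \<in> carrier E" for a
  proof -
    have "q a \<in> f ` carrier L"
      using bij that by (simp add: bij_betw_imp_surj_on Q(1))
    then show "p a \<in> carrier L" "f (p a) = q a"
      unfolding p_def by (rule inv_into_into, rule f_inv_into_f)
  qed
  have inj: "x = y" if "f x = f y" "x \<in> carrier L" "y \<in> carrier L" for x y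
    using bij that by (meson bij_betw_imp_inj_on inj_onD)
  have p: "p \<in> hom_leibniz_hom K E L"
    unfolding hom_leibniz_hom_def
    by (auto intro!: inj simp: p_closed f_p f_hom Q L.bracket_closed L.twist_closed
        E.bracket_closed E.twist_closed)
  have "x \<in> p ` carrier E" if x: "x \<in> carrier L" for x
  proof -
    obtain a where "a \<in> carrier E" "f x = q a"
      using f_hom(1)[OF x] by (auto simp: Q(1))
    then show ?thesis
      using inj[of x "p a"] x by (simp add: f_p p_closed)
  qed
  then have surj: "p ` carrier E = carrier L"
    using p_closed by blast
  have p_zero: "p \<zero>\<^bsub>E\<^esub> = \<zero>\<^bsub>L\<^esub>"
    using hom_leibniz_homD(3)[OF p, of "\<zero>\<^bsub>K\<^esub>" "\<zero>\<^bsub>E\<^esub>"] p_closed by simp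
  have "p a = \<zero>\<^bsub>L\<^esub> \<longleftrightarrow> a \<in> alpha_center E" if a: "a \<in> carrier E" for a
  proof -
    have "p a = \<zero>\<^bsub>L\<^esub> \<longleftrightarrow> f (p \<zero>\<^bsub>E\<^esub>) = f (p a)"
      using inj[of "p \<zero>\<^bsub>E\<^esub>" "p a"] a p_closed by (auto simp: p_zero)
    also have "\<dots> \<longleftrightarrow> q \<zero>\<^bsub>E\<^esub> = q a"
      using a by (simp add: f_p)
    also have "\<dots> \<longleftrightarrow> a \<in> alpha_center E"
      using a E.alpha_center_coset_iff[of "\<zero>\<^bsub>E\<^esub>" a]
        E.M.minus_equality[of "\<zero>\<^bsub>E\<^esub>" "\<zero>\<^bsub>E\<^esub>"]
      by (simp add: q_def E.M.minus_eq)
    finally show ?thesis .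
  qed
  then show "\<exists>(E :: ('k, 'b) hom_algebra) p. alpha_central_cover K E L p"
    using E p surj unfolding alpha_central_cover_def by blast
next
  interpret L: hom_leibniz_algebra K L by (rule L)
  assume "\<exists>(E :: ('k, 'b) hom_algebra) p. alpha_central_cover K E L p"
  then obtain E :: "('k, 'b) hom_algebra" and p
    where E: "hom_leibniz_algebra K E" and p: "p \<in> hom_leibniz_hom K E L"
      and surj: "p ` carrier E = carrier L"
      and ker: "\<And>a. a \<in> carrier E \<Longrightarrow> p a = \<zero>\<^bsub>L\<^esub> \<longleftrightarrow> a \<in> alpha_center E"
    unfolding alpha_central_cover_def by blast
  interpret E: hom_leibniz_algebra K E by (rule E)
  define q where "q = (\<lambda>a. alpha_center E +>\<^bsub>E\<^esub> a)"
  note Q = E.quot_alpha_center_simps[folded q_def]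
  note p_hom = hom_leibniz_homD[OF p]
  have q_eq: "q a = q b \<longleftrightarrow> p a = p b" if "a \<in> carrier E" "b \<in> carrier E" for a b
    using that E.alpha_center_coset_iff[of a b] ker[of "b \<ominus>\<^bsub>E\<^esub> a"]
    by (auto simp: q_def p_hom L.minus_eq_zero_iff hom_leibniz_hom_minus[OF E L p])
  define f where "f = (\<lambda>x. q (inv_into (carrier E) p x))"
  have f_p: "f (p a) = q a" if "a \<in> carrier E" for a
    using that by (simp add: f_def q_eq inv_into_into f_inv_into_f)
  have lift: "\<exists>a\<in>carrier E. x = p a" if "x \<in> carrier L" for x
    using surj that by blast
  have "f \<in> hom_leibniz_hom K L (quot_hom_algebra E (alpha_center E))"
    unfolding hom_leibniz_hom_def
    by (auto dest!: lift simp: f_p Q E.bracket_closed E.twist_closed p_hom(2-5)[symmetric])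
  moreover have "bij_betw f (carrier L) (carrier (quot_hom_algebra E (alpha_center E)))"
    unfolding bij_betw_def inj_on_def Q(1) surj[symmetric]
    by (auto simp: f_p q_eq image_image)
  ultimately show "capable TYPE('b) K L"
    using E unfolding capable_def hom_leibniz_isomorphic_def by blast
qed

section \<open>The exterior product as a module\<close>

context hom_leibniz_algebra
begin

lemma ext_cong_ext_terms: "(s, t) \<in> ext_cong K L \<Longrightarrow> s \<in> ext_terms K L \<and> t \<in> ext_terms K L"
  by (induction rule: ext_cong.induct)
    (auto intro!: ext_terms.intros bracket_closed twist_closed)

lemma equiv_ext_cong: "equiv (ext_terms K L) (ext_cong K L)"
  by (intro equivI refl_onI symI transI)
    (auto dest: ext_cong_ext_terms intro: ext_cong.refl ext_cong.sym ext_cong.trans)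

lemma ext_class_eqI: "(s, t) \<in> ext_cong K L \<Longrightarrow> ext_class K L s = ext_class K L t"
  unfolding ext_class_def by (rule equiv_class_eq[OF equiv_ext_cong])

lemma ext_class_eqD:
  "\<lbrakk>ext_class K L s = ext_class K L t; t \<in> ext_terms K L\<rbrakk> \<Longrightarrow> (s, t) \<in> ext_cong K L"
  unfolding ext_class_def by (rule eq_equiv_class[OF _ equiv_ext_cong])

lemma exterior_product_simps:
  shows "carrier (exterior_product K L) = ext_class K L ` ext_terms K L"
    and "\<zero>\<^bsub>exterior_product K L\<^esub> = ext_class K L Zero"
    and "\<lbrakk>s \<in> ext_terms K L; t \<in> ext_terms K L\<rbrakk> \<Longrightarrow>
      ext_class K L s \<oplus>\<^bsub>exterior_product K L\<^esub> ext_class K L t = ext_class K L (Plus s t)"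
    and "\<lbrakk>c \<in> carrier K; s \<in> ext_terms K L\<rbrakk> \<Longrightarrow>
      c \<odot>\<^bsub>exterior_product K L\<^esub> ext_class K L s = ext_class K L (Scale c s)"
    and "s \<in> ext_terms K L \<Longrightarrow>
      twist (exterior_product K L) (ext_class K L s) = ext_class K L (Twist s)"
proof -
  have nonempty: "ext_class K L s \<noteq> {}" if "s \<in> ext_terms K L" for s
    using ext_cong.refl[OF that] by (auto simp: ext_class_def)
  show "carrier (exterior_product K L) = ext_class K L ` ext_terms K L"
    by (auto simp: exterior_product_def quotient_def ext_class_def)
  show "\<zero>\<^bsub>exterior_product K L\<^esub> = ext_class K L Zero"
    by (simp add: exterior_product_def)
  show "ext_class K L s \<oplus>\<^bsub>exterior_product K L\<^esub> ext_class K L t = ext_class K L (Plus s t)"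
    if "s \<in> ext_terms K L" "t \<in> ext_terms K L"
    unfolding exterior_product_def ring_record_simps
    by (intro SUP_eq_const nonempty that ext_class_eqI
        ext_cong.Plus_cong ext_cong.sym[of s] ext_cong.sym[of t])
      (simp_all add: ext_class_def)
  show "c \<odot>\<^bsub>exterior_product K L\<^esub> ext_class K L s = ext_class K L (Scale c s)"
    if "c \<in> carrier K" "s \<in> ext_terms K L"
    unfolding exterior_product_def module.simps
    by (intro SUP_eq_const nonempty that ext_class_eqI ext_cong.Scale_cong
        ext_cong.sym[of s]) (simp add: ext_class_def)
  show "twist (exterior_product K L) (ext_class K L s) = ext_class K L (Twist s)"
    if "s \<in> ext_terms K L"
    unfolding exterior_product_def hom_algebra.simps
    by (intro SUP_eq_const nonempty that ext_class_eqI ext_cong.Twist_cong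
        ext_cong.sym[of s]) (simp add: ext_class_def)
qed

lemma exterior_product_module: "module K (exterior_product K L)"
proof -
  note [simp] = exterior_product_simps ext_terms.intros
  show ?thesis
  proof (rule moduleI)
    show "cring K" ..
    show "abelian_group (exterior_product K L)"
    proof (rule abelian_groupI)
      show "\<exists>y\<in>carrier (exterior_product K L).
          y \<oplus>\<^bsub>exterior_product K L\<^esub> x = \<zero>\<^bsub>exterior_product K L\<^esub>"
        if x: "x \<in> carrier (exterior_product K L)" for x
      proof -
        obtain s where s: "s \<in> ext_terms K L" "x = ext_class K L s"
          using x by auto
        show ?thesis
          by (rule bexI[of _ "ext_class K L (Neg s)"])
            (use s in \<open>simp_all add: ext_class_eqI[OF ext_cong.Plus_Neg]\<close>)
      qed
      show "x \<oplus>\<^bsub>exterior_product K L\<^esub> y = y \<oplus>\<^bsub>exterior_product K L\<^esub> x"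
        if "x \<in> carrier (exterior_product K L)" "y \<in> carrier (exterior_product K L)" for x y
        using that by (auto simp: ext_cong.Plus_comm[THEN ext_class_eqI])
    qed (auto simp: ext_cong.Plus_assoc[THEN ext_class_eqI] ext_cong.Plus_Zero[THEN ext_class_eqI])
  qed (auto simp: ext_cong.Scale_add[THEN ext_class_eqI] ext_cong.Scale_Plus[THEN ext_class_eqI]
      ext_cong.Scale_mult[THEN ext_class_eqI] ext_cong.Scale_one[THEN ext_class_eqI])
qed

end

section \<open>Pairings that satisfy the relations of the exterior product\<close>

text \<open>
  The relation that exchanges \<open>[x, y] \<curlywedge> \<alpha>(z)\<close> and \<open>[x, z] \<curlywedge> \<alpha>(y)\<close> is the Leibniz relation for
  \<open>(x, z, y)\<close>, rearranged; \<open>leibniz\<close> covers both.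
\<close>

locale exterior_pairing = E: hom_leibniz_algebra K E + L: hom_leibniz_algebra K L
  for K :: "('k, 'r) ring_scheme" and E :: "('k, 'b) hom_algebra" and L :: "('k, 'a) hom_algebra" +
  fixes \<omega> :: "'a \<Rightarrow> 'a \<Rightarrow> 'b"
  assumes closed: "\<lbrakk>x \<in> carrier L; y \<in> carrier L\<rbrakk> \<Longrightarrow> \<omega> x y \<in> carrier E"
    and add_left: "\<lbrakk>x \<in> carrier L; y \<in> carrier L; z \<in> carrier L\<rbrakk> \<Longrightarrow>
      \<omega> (x \<oplus>\<^bsub>L\<^esub> y) z = \<omega> x z \<oplus>\<^bsub>E\<^esub> \<omega> y z"
    and add_right: "\<lbrakk>x \<in> carrier L; y \<in> carrier L; z \<in> carrier L\<rbrakk> \<Longrightarrow>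
      \<omega> z (x \<oplus>\<^bsub>L\<^esub> y) = \<omega> z x \<oplus>\<^bsub>E\<^esub> \<omega> z y"
    and smult_left: "\<lbrakk>c \<in> carrier K; x \<in> carrier L; y \<in> carrier L\<rbrakk> \<Longrightarrow>
      \<omega> (c \<odot>\<^bsub>L\<^esub> x) y = c \<odot>\<^bsub>E\<^esub> \<omega> x y"
    and smult_right: "\<lbrakk>c \<in> carrier K; x \<in> carrier L; y \<in> carrier L\<rbrakk> \<Longrightarrow>
      \<omega> x (c \<odot>\<^bsub>L\<^esub> y) = c \<odot>\<^bsub>E\<^esub> \<omega> x y"
    and alternating: "\<lbrakk>x \<in> carrier L; y \<in> carrier L; z \<in> carrier L\<rbrakk> \<Longrightarrow>
      \<omega> (twist L x) (y \<otimes>\<^bsub>L\<^esub> z) = \<ominus>\<^bsub>E\<^esub> \<omega> (twist L x) (z \<otimes>\<^bsub>L\<^esub> y)"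
    and leibniz: "\<lbrakk>x \<in> carrier L; y \<in> carrier L; z \<in> carrier L\<rbrakk> \<Longrightarrow>
      \<omega> (twist L x) (y \<otimes>\<^bsub>L\<^esub> z) =
        \<omega> (x \<otimes>\<^bsub>L\<^esub> y) (twist L z) \<ominus>\<^bsub>E\<^esub> \<omega> (x \<otimes>\<^bsub>L\<^esub> z) (twist L y)"
    and bracket: "\<lbrakk>x \<in> carrier L; y \<in> carrier L; x' \<in> carrier L; y' \<in> carrier L\<rbrakk> \<Longrightarrow>
      \<omega> x y \<otimes>\<^bsub>E\<^esub> \<omega> x' y' = \<omega> (x \<otimes>\<^bsub>L\<^esub> y) (x' \<otimes>\<^bsub>L\<^esub> y')"
    and twist: "\<lbrakk>x \<in> carrier L; y \<in> carrier L\<rbrakk> \<Longrightarrow>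
      twist E (\<omega> x y) = \<omega> (twist L x) (twist L y)"
begin

primrec eval :: "('k, 'a) ext_term \<Rightarrow> 'b" where
  "eval (Wedge x y) = \<omega> x y"
| "eval Zero = \<zero>\<^bsub>E\<^esub>"
| "eval (Plus s t) = eval s \<oplus>\<^bsub>E\<^esub> eval t"
| "eval (Neg s) = \<ominus>\<^bsub>E\<^esub> eval s"
| "eval (Scale c s) = c \<odot>\<^bsub>E\<^esub> eval s"
| "eval (Bracket s t) = eval s \<otimes>\<^bsub>E\<^esub> eval t"
| "eval (Twist s) = twist E (eval s)"

lemma eval_closed: "t \<in> ext_terms K L \<Longrightarrow> eval t \<in> carrier E"
  by (induction rule: ext_terms.induct) (simp_all add: closed E.bracket_closed E.twist_closed)

text \<open>
  The universal property of the exterior product: each generator of the congruence holds in \<open>E\<close>,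
  so the evaluation descends to the classes.
\<close>

lemma eval_cong: "(s, t) \<in> ext_cong K L \<Longrightarrow> eval s = eval t"
proof (induction rule: ext_cong.induct)
  case (Plus_assoc s t u)
  then show ?case by (simp add: eval_closed E.M.a_assoc)
next
  case (Plus_comm s t)
  then show ?case by (simp add: eval_closed E.M.a_comm)
next
  case (Wedge_alternating x y z)
  then show ?case unfolding eval.simps by (rule alternating)
next
  case (Wedge_leibniz x y z)
  then show ?case by (simp add: leibniz E.M.minus_eq)
next
  \<comment> \<open>with \<open>b\<close>, \<open>c\<close> as below, the Leibniz relation turns the right-hand side into \<open>b - (b - c)\<close>\<close>
  case (Wedge_leibniz' x y z)
  let ?b = "\<omega> (x \<otimes>\<^bsub>L\<^esub> z) (twist L y)" and ?c = "\<omega> (x \<otimes>\<^bsub>L\<^esub> y) (twist L z)"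
  have "?b \<in> carrier E" "?c \<in> carrier E"
    using Wedge_leibniz' by (simp_all add: closed L.bracket_closed L.twist_closed)
  then show ?case
    using Wedge_leibniz'
    by (simp add: leibniz E.M.minus_eq E.M.minus_add E.M.a_assoc[symmetric] E.M.r_neg)
qed (simp_all add: eval_closed closed add_left add_right smult_left smult_right bracket twist
    E.M.l_neg E.smult_l_distr E.smult_r_distr E.smult_assoc1
    E.bracket_add_left E.bracket_add_right E.bracket_smult_left E.bracket_smult_right
    E.twist_add E.twist_smult E.hom_leibniz E.multiplicative E.M.minus_eq)

end

lemma (in exterior_pairing) vanishes_if_wedge_zero:
  assumes "x \<in> carrier L" "y \<in> carrier L" "wedge K L x y = \<zero>\<^bsub>exterior_product K L\<^esub>"
  shows "\<omega> x y = \<zero>\<^bsub>E\<^esub>"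
  using eval_cong[OF L.ext_class_eqD[of "Wedge x y" Zero]] assms
  by (simp add: wedge_def L.exterior_product_simps ext_terms.intros)

section \<open>Extensions by a cocycle\<close>

text \<open>
  The bracket ignores the second components, so that \<open>0 \<times> V\<close> annihilates the extension.  The
  coefficients are a \<^type>\<open>hom_algebra\<close> so that they carry a twist.
\<close>

definition cocycle_extension ::
    "('k, 'a) hom_algebra \<Rightarrow> ('k, 'b) hom_algebra \<Rightarrow> ('a \<Rightarrow> 'a \<Rightarrow> 'b) \<Rightarrow> ('k, 'a \<times> 'b) hom_algebra" where
  "cocycle_extension L V \<omega> =
     \<lparr>carrier = carrier L \<times> carrier V,
      mult = (\<lambda>(x, u) (y, v). (x \<otimes>\<^bsub>L\<^esub> y, \<omega> x y)),
      one = undefined,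
      zero = (\<zero>\<^bsub>L\<^esub>, \<zero>\<^bsub>V\<^esub>),
      add = (\<lambda>(x, u) (y, v). (x \<oplus>\<^bsub>L\<^esub> y, u \<oplus>\<^bsub>V\<^esub> v)),
      smult = (\<lambda>c (x, u). (c \<odot>\<^bsub>L\<^esub> x, c \<odot>\<^bsub>V\<^esub> u)),
      twist = map_prod (twist L) (twist V)\<rparr>"

locale hom_leibniz_cocycle = L: hom_leibniz_algebra K L + V: module K V
  for K :: "('k, 'r) ring_scheme" and L :: "('k, 'a) hom_algebra" and V :: "('k, 'b) hom_algebra" +
  fixes \<omega> :: "'a \<Rightarrow> 'a \<Rightarrow> 'b"
  assumes twist_closed: "u \<in> carrier V \<Longrightarrow> twist V u \<in> carrier V"
    and twist_add:
      "\<lbrakk>u \<in> carrier V; v \<in> carrier V\<rbrakk> \<Longrightarrow> twist V (u \<oplus>\<^bsub>V\<^esub> v) = twist V u \<oplus>\<^bsub>V\<^esub> twist V v"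
    and twist_smult:
      "\<lbrakk>c \<in> carrier K; u \<in> carrier V\<rbrakk> \<Longrightarrow> twist V (c \<odot>\<^bsub>V\<^esub> u) = c \<odot>\<^bsub>V\<^esub> twist V u"
    and closed: "\<lbrakk>x \<in> carrier L; y \<in> carrier L\<rbrakk> \<Longrightarrow> \<omega> x y \<in> carrier V"
    and add_left: "\<lbrakk>x \<in> carrier L; y \<in> carrier L; z \<in> carrier L\<rbrakk> \<Longrightarrow>
      \<omega> (x \<oplus>\<^bsub>L\<^esub> y) z = \<omega> x z \<oplus>\<^bsub>V\<^esub> \<omega> y z"
    and add_right: "\<lbrakk>x \<in> carrier L; y \<in> carrier L; z \<in> carrier L\<rbrakk> \<Longrightarrow>
      \<omega> z (x \<oplus>\<^bsub>L\<^esub> y) = \<omega> z x \<oplus>\<^bsub>V\<^esub> \<omega> z y"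
    and smult_left: "\<lbrakk>c \<in> carrier K; x \<in> carrier L; y \<in> carrier L\<rbrakk> \<Longrightarrow>
      \<omega> (c \<odot>\<^bsub>L\<^esub> x) y = c \<odot>\<^bsub>V\<^esub> \<omega> x y"
    and smult_right: "\<lbrakk>c \<in> carrier K; x \<in> carrier L; y \<in> carrier L\<rbrakk> \<Longrightarrow>
      \<omega> x (c \<odot>\<^bsub>L\<^esub> y) = c \<odot>\<^bsub>V\<^esub> \<omega> x y"
    and cocycle: "\<lbrakk>x \<in> carrier L; y \<in> carrier L; z \<in> carrier L\<rbrakk> \<Longrightarrow>
      \<omega> (twist L x) (y \<otimes>\<^bsub>L\<^esub> z) =
        \<omega> (x \<otimes>\<^bsub>L\<^esub> y) (twist L z) \<ominus>\<^bsub>V\<^esub> \<omega> (x \<otimes>\<^bsub>L\<^esub> z) (twist L y)"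
    and twist: "\<lbrakk>x \<in> carrier L; y \<in> carrier L\<rbrakk> \<Longrightarrow>
      twist V (\<omega> x y) = \<omega> (twist L x) (twist L y)"
begin

abbreviation "E \<equiv> cocycle_extension L V \<omega>"

lemma extension_simps:
  shows "carrier E = carrier L \<times> carrier V"
    and "(x, u) \<otimes>\<^bsub>E\<^esub> (y, v) = (x \<otimes>\<^bsub>L\<^esub> y, \<omega> x y)"
    and "\<zero>\<^bsub>E\<^esub> = (\<zero>\<^bsub>L\<^esub>, \<zero>\<^bsub>V\<^esub>)"
    and "(x, u) \<oplus>\<^bsub>E\<^esub> (y, v) = (x \<oplus>\<^bsub>L\<^esub> y, u \<oplus>\<^bsub>V\<^esub> v)"
    and "c \<odot>\<^bsub>E\<^esub> (x, u) = (c \<odot>\<^bsub>L\<^esub> x, c \<odot>\<^bsub>V\<^esub> u)"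
    and "twist E (x, u) = (twist L x, twist V u)"
  by (simp_all add: cocycle_extension_def)

lemma extension_module: "module K E"
proof (rule moduleI)
  show "cring K" ..
  show "abelian_group E"
  proof (rule abelian_groupI)
    show "\<exists>b\<in>carrier E. b \<oplus>\<^bsub>E\<^esub> a = \<zero>\<^bsub>E\<^esub>" if a: "a \<in> carrier E" for a
    proof -
      obtain x u where "a = (x, u)" "x \<in> carrier L" "u \<in> carrier V"
        using a by (auto simp: extension_simps)
      then show ?thesis
        by (intro bexI[of _ "(\<ominus>\<^bsub>L\<^esub> x, \<ominus>\<^bsub>V\<^esub> u)"])
          (simp_all add: extension_simps L.M.l_neg V.M.l_neg)
    qed
    show "a \<oplus>\<^bsub>E\<^esub> b = b \<oplus>\<^bsub>E\<^esub> a" if "a \<in> carrier E" "b \<in> carrier E" for a b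
      using that by (auto simp: extension_simps L.M.a_comm V.M.a_comm)
  qed (auto simp: extension_simps L.M.a_assoc V.M.a_assoc)
qed (auto simp: extension_simps L.smult_l_distr V.smult_l_distr L.smult_r_distr V.smult_r_distr
    L.smult_assoc1 V.smult_assoc1)

lemma extension_hom_leibniz: "hom_leibniz_algebra K E"
proof (intro hom_leibniz_algebra.intro hom_leibniz_algebra_axioms.intro extension_module)
  interpret E: module K E by (rule extension_module)
  show "field K" by (rule L.field_K)
  have minus: "(x, u) \<ominus>\<^bsub>E\<^esub> (y, v) = (x \<ominus>\<^bsub>L\<^esub> y, u \<ominus>\<^bsub>V\<^esub> v)"
    if "x \<in> carrier L" "u \<in> carrier V" "y \<in> carrier L" "v \<in> carrier V" for x u y v
  proof -
    have "\<ominus>\<^bsub>E\<^esub> (y, v) = (\<ominus>\<^bsub>L\<^esub> y, \<ominus>\<^bsub>V\<^esub> v)"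
      using that by (intro E.M.minus_equality) (simp_all add: extension_simps L.M.l_neg V.M.l_neg)
    then show ?thesis
      by (simp add: E.M.minus_eq L.M.minus_eq V.M.minus_eq extension_simps)
  qed
  show "twist E a \<otimes>\<^bsub>E\<^esub> (b \<otimes>\<^bsub>E\<^esub> c) =
      (a \<otimes>\<^bsub>E\<^esub> b) \<otimes>\<^bsub>E\<^esub> twist E c \<ominus>\<^bsub>E\<^esub> (a \<otimes>\<^bsub>E\<^esub> c) \<otimes>\<^bsub>E\<^esub> twist E b"
    if "a \<in> carrier E" "b \<in> carrier E" "c \<in> carrier E" for a b c
    using that by (auto simp: extension_simps minus closed cocycle L.bracket_closed L.twist_closed
        L.hom_leibniz)
qed (auto simp: extension_simps closed add_left add_right smult_left smult_right twist
    twist_closed twist_add twist_smult L.bracket_closed L.twist_closed L.bracket_add_left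
    L.bracket_add_right L.bracket_smult_left L.bracket_smult_right L.twist_add L.twist_smult
    L.multiplicative)

text \<open>
  The second component of an element never enters its brackets, while the first component enters
  both \<open>[x, y]\<close> and \<open>\<omega> x y\<close>.
\<close>

lemma alpha_center_extension:
  "alpha_center E = {x \<in> alpha_center L. \<forall>y\<in>carrier L. \<forall>n.
     \<omega> ((twist L ^^ n) x) y = \<zero>\<^bsub>V\<^esub> \<and> \<omega> y ((twist L ^^ n) x) = \<zero>\<^bsub>V\<^esub>} \<times> carrier V"
proof -
  have funpow: "(twist E ^^ n) (x, u) = ((twist L ^^ n) x, (twist V ^^ n) u)" for n x u
    by (induction n) (simp_all add: extension_simps)
  show ?thesis
    unfolding alpha_center_def
    by (auto simp: extension_simps funpow)
qed

end

section \<open>Capability and the exterior center\<close>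

context hom_leibniz_algebra
begin

text \<open>
  The cocycle condition is the Leibniz relation of the exterior product.
\<close>

lemma wedge_cocycle: "hom_leibniz_cocycle K L (exterior_product K L) (wedge K L)"
proof -
  note [simp] = exterior_product_simps ext_terms.intros wedge_def bracket_closed twist_closed
  interpret V: module K "exterior_product K L"
    by (rule exterior_product_module)
  have neg: "\<ominus>\<^bsub>exterior_product K L\<^esub> ext_class K L s = ext_class K L (Neg s)"
    if "s \<in> ext_terms K L" for s
    using that by (intro V.M.minus_equality) (simp_all add: ext_class_eqI[OF ext_cong.Plus_Neg])
  have minus: "ext_class K L s \<ominus>\<^bsub>exterior_product K L\<^esub> ext_class K L t =
      ext_class K L (Plus s (Neg t))"
    if "s \<in> ext_terms K L" "t \<in> ext_terms K L" for s t
    using that by (simp add: V.M.minus_eq neg)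
  show ?thesis
  proof (intro hom_leibniz_cocycle.intro hom_leibniz_cocycle_axioms.intro
      hom_leibniz_algebra_axioms exterior_product_module)
    show "wedge K L (twist L x) (y \<otimes>\<^bsub>L\<^esub> z) =
        wedge K L (x \<otimes>\<^bsub>L\<^esub> y) (twist L z) \<ominus>\<^bsub>exterior_product K L\<^esub>
        wedge K L (x \<otimes>\<^bsub>L\<^esub> z) (twist L y)"
      if "x \<in> carrier L" "y \<in> carrier L" "z \<in> carrier L" for x y z
      using that by (simp add: minus ext_class_eqI[OF ext_cong.Wedge_leibniz])
  qed (auto simp: ext_cong.Twist_Plus[THEN ext_class_eqI] ext_cong.Twist_Scale[THEN ext_class_eqI]
      ext_cong.Wedge_add_left[THEN ext_class_eqI] ext_cong.Wedge_add_right[THEN ext_class_eqI]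
      ext_cong.Wedge_smult_left[THEN ext_class_eqI] ext_cong.Wedge_smult_right[THEN ext_class_eqI]
      ext_cong.Twist_Wedge[THEN ext_class_eqI])
qed

lemma zero_in_exterior_center: "\<zero>\<^bsub>L\<^esub> \<in> exterior_center K L"
proof -
  interpret V: hom_leibniz_cocycle K L "exterior_product K L" "wedge K L"
    by (rule wedge_cocycle)
  have "wedge K L \<zero>\<^bsub>L\<^esub> y = \<zero>\<^bsub>exterior_product K L\<^esub> \<and> wedge K L y \<zero>\<^bsub>L\<^esub> = \<zero>\<^bsub>exterior_product K L\<^esub>"
    if "y \<in> carrier L" for y
    using that V.smult_left[of "\<zero>\<^bsub>K\<^esub>" "\<zero>\<^bsub>L\<^esub>" y] V.smult_right[of "\<zero>\<^bsub>K\<^esub>" y "\<zero>\<^bsub>L\<^esub>"]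
    by (simp add: V.closed)
  then show ?thesis
    by (simp add: exterior_center_def twist_funpow_zero)
qed

lemma wedge_extension_cover:
  assumes "exterior_center K L = {\<zero>\<^bsub>L\<^esub>}"
  shows "alpha_central_cover K (cocycle_extension L (exterior_product K L) (wedge K L)) L fst"
proof -
  interpret V: hom_leibniz_cocycle K L "exterior_product K L" "wedge K L"
    by (rule wedge_cocycle)
  have "fst \<in> hom_leibniz_hom K V.E L"
    by (auto simp: hom_leibniz_hom_def V.extension_simps)
  moreover have "fst ` carrier V.E = carrier L"
    using V.V.M.zero_closed by (auto simp: V.extension_simps)
  moreover have "x = \<zero>\<^bsub>L\<^esub> \<longleftrightarrow> (x, u) \<in> alpha_center V.E"
    if "x \<in> carrier L" "u \<in> carrier (exterior_product K L)" for x u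
  proof -
    have "(x, u) \<in> alpha_center V.E \<longleftrightarrow> x \<in> alpha_center L \<and> x \<in> exterior_center K L"
      using that by (simp add: V.alpha_center_extension exterior_center_def)
    then show ?thesis
      using alpha_center_zero by (auto simp: assms)
  qed
  ultimately show ?thesis
    unfolding alpha_central_cover_def using V.extension_hom_leibniz
    by (auto simp: V.extension_simps)
qed

text \<open>
  Given a cover \<open>p\<close>, brackets of lifts form an exterior pairing.  It can be nonzero only where the
  wedge is nonzero, so a lift of an element of the exterior center is killed by all brackets.
\<close>

lemma exterior_center_trivial_if_cover:
  assumes cover: "alpha_central_cover K E L p"
  shows "exterior_center K L = {\<zero>\<^bsub>L\<^esub>}"
proof -
  have L: "hom_leibniz_algebra K L" ..
  have E: "hom_leibniz_algebra K E" and p: "p \<in> hom_leibniz_hom K E L"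
    and surj: "p ` carrier E = carrier L"
    and ker: "\<And>a. a \<in> carrier E \<Longrightarrow> p a = \<zero>\<^bsub>L\<^esub> \<longleftrightarrow> a \<in> alpha_center E"
    using cover unfolding alpha_central_cover_def by blast+
  interpret E: hom_leibniz_algebra K E by (rule E)
  note p_hom = hom_leibniz_homD[OF p]
  define \<omega> where
    "\<omega> = (\<lambda>x y. inv_into (carrier E) p x \<otimes>\<^bsub>E\<^esub> inv_into (carrier E) p y)"
  have diff: "a \<ominus>\<^bsub>E\<^esub> b \<in> alpha_center E"
    if "a \<in> carrier E" "b \<in> carrier E" "p a = p b" for a b
    using that ker[of "a \<ominus>\<^bsub>E\<^esub> b"]
    by (simp add: hom_leibniz_hom_minus[OF E L p] p_hom M.minus_eq M.r_neg)
  have \<omega>_p: "\<omega> (p a) (p b) = a \<otimes>\<^bsub>E\<^esub> b" if "a \<in> carrier E" "b \<in> carrier E" for a b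
    unfolding \<omega>_def
    by (intro E.bracket_cong_alpha_center diff)
      (use that in \<open>auto simp: inv_into_into f_inv_into_f\<close>)
  have lift: "\<exists>a\<in>carrier E. x = p a" if "x \<in> carrier L" for x
    using surj that by blast
  interpret exterior_pairing K E L \<omega>
  proof (intro exterior_pairing.intro exterior_pairing_axioms.intro E L)
    fix x y z assume "x \<in> carrier L" "y \<in> carrier L" "z \<in> carrier L"
    then obtain a b c where "a \<in> carrier E" "b \<in> carrier E" "c \<in> carrier E"
      and "x = p a" "y = p b" "z = p c"
      using lift by meson
    \<comment> \<open>by the Hom-Leibniz identity, \<open>[\<alpha>(a), [b, c]]\<close> is a difference that changes sign with \<open>b \<leftrightarrow> c\<close>\<close>
    then show "\<omega> (twist L x) (y \<otimes>\<^bsub>L\<^esub> z) = \<ominus>\<^bsub>E\<^esub> \<omega> (twist L x) (z \<otimes>\<^bsub>L\<^esub> y)"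
      by (simp add: \<omega>_p E.bracket_closed E.twist_closed E.hom_leibniz E.M.minus_eq E.M.minus_add
          E.M.a_comm p_hom(2-5)[symmetric])
  qed (auto dest!: lift simp: \<omega>_p E.bracket_closed E.twist_closed E.bracket_add_left
      E.bracket_add_right E.bracket_smult_left E.bracket_smult_right E.hom_leibniz
      E.multiplicative p_hom(2-5)[symmetric])
  have "x = \<zero>\<^bsub>L\<^esub>" if x: "x \<in> exterior_center K L" for x
  proof -
    obtain a where a: "a \<in> carrier E" "x = p a"
      using x lift unfolding exterior_center_def by blast
    have funpow: "(twist L ^^ n) (p a) = p ((twist E ^^ n) a)" for n
      by (induction n) (simp_all add: p_hom E.twist_funpow_closed a)
    have "(twist E ^^ n) a \<otimes>\<^bsub>E\<^esub> b = \<zero>\<^bsub>E\<^esub> \<and> b \<otimes>\<^bsub>E\<^esub> (twist E ^^ n) a = \<zero>\<^bsub>E\<^esub>"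
      if b: "b \<in> carrier E" for b n
    proof -
      have "wedge K L (p ((twist E ^^ n) a)) (p b) = \<zero>\<^bsub>exterior_product K L\<^esub>"
        "wedge K L (p b) (p ((twist E ^^ n) a)) = \<zero>\<^bsub>exterior_product K L\<^esub>"
        using x p_hom(1)[OF b] by (simp_all add: exterior_center_def a(2) funpow)
      then show ?thesis
        using vanishes_if_wedge_zero a(1) b
        by (simp add: p_hom(1) E.twist_funpow_closed flip: \<omega>_p)
    qed
    then have "a \<in> alpha_center E"
      using a(1) by (simp add: alpha_center_def)
    then show ?thesis
      using ker a by simp
  qed
  then show ?thesis
    using zero_in_exterior_center by blast
qed

end

theorem theorem5p6:
  fixes K :: "('k, 'r) ring_scheme" and L :: "('k, 'a) hom_algebra"
  assumes "hom_leibniz_algebra K L"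
  shows "(capable TYPE('a \<times> ('k, 'a) ext_term set) K L \<longleftrightarrow> exterior_center K L = {\<zero>\<^bsub>L\<^esub>}) \<and>
         (capable TYPE('b) K L \<longrightarrow> exterior_center K L = {\<zero>\<^bsub>L\<^esub>})"
proof -
  interpret hom_leibniz_algebra K L by (rule assms)
  show ?thesis
    unfolding capable_iff_alpha_central_cover[OF assms]
  proof (intro conjI iffI impI)
    assume "exterior_center K L = {\<zero>\<^bsub>L\<^esub>}"
    then show "\<exists>(E :: ('k, 'a \<times> ('k, 'a) ext_term set) hom_algebra) p. alpha_central_cover K E L p"
      using wedge_extension_cover by blast
  qed (elim exE, rule exterior_center_trivial_if_cover, assumption)+
qed

end
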